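(* For every graph $G$, $\gamma_R(G)+1\leq \gamma_R(\mu(G))\leq \gamma_R(G)+2$.
   Context: All graphs are finite and simple. A Roman dominating function (RDF) of a graph $G=(V,E)$ is a function $f:V\to\{0,1,2\}$ such that every vertex $v$ with $f(v)=0$ has a neighbor $w$ with $f(w)=2$; its weight is $\sum_{v\in V}f(v)$, and $\gamma_R(G)$ is the minimum weight of an RDF of $G$. The Mycielskian $\mu(G)$ of $G$ with $V(G)=\{v_1^0,\ldots,v_n^0\}$ is the graph with vertex set $\{v_1^0,\ldots,v_n^0\}\cup\{v_1^1,\ldots,v_n^1\}\cup\{u\}$ and edge set $E(G)\cup\{v_j^0v_{j'}^1 : v_j^0v_{j'}^0\in E(G)\}\cup\{v_j^1u: 1\leq j\leq n\}$. *)

theory Defs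
  imports "Graph_Theory.Graph_Theory"
begin

text \<open>
  A finite simple graph is a \<open>pair_graph\<close>: a finite vertex set with a symmetric, irreflexive arc
  relation on it, so that an undirected edge \<open>vw\<close> is represented by the two arcs \<open>(v, w)\<close> and
  \<open>(w, v)\<close>. The graph without vertices is included.
\<close>

text \<open>Only the values of \<open>f\<close> on the vertices of \<open>G\<close> matter.\<close>

definition roman_dominating :: "'a pair_pre_digraph \<Rightarrow> ('a \<Rightarrow> nat) \<Rightarrow> bool" where
  "roman_dominating G f \<longleftrightarrow>
     (\<forall>v\<in>pverts G. f v \<in> {0, 1, 2}) \<and>
     (\<forall>v\<in>pverts G. f v = 0 \<longrightarrow> (\<exists>w\<in>pverts G. (v, w) \<in> parcs G \<and> f w = 2))"

definition rdf_weight :: "'a pair_pre_digraph \<Rightarrow> ('a \<Rightarrow> nat) \<Rightarrow> nat" where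
  "rdf_weight G f = (\<Sum>v\<in>pverts G. f v)"

definition roman_domination_number :: "'a pair_pre_digraph \<Rightarrow> nat" (\<open>\<gamma>\<^sub>R\<close>) where
  "\<gamma>\<^sub>R G = (LEAST k. \<exists>f. roman_dominating G f \<and> rdf_weight G f = k)"

text \<open>The minimum is taken over a nonempty set, so it is attained.\<close>

lemma roman_domination_number_attained:
  "\<exists>f. roman_dominating G f \<and> rdf_weight G f = \<gamma>\<^sub>R G"
proof -
  have "roman_dominating G (\<lambda>_. 1)"
    by (simp add: roman_dominating_def)
  then have "\<exists>k f. roman_dominating G f \<and> rdf_weight G f = k"
    by blast
  then show ?thesis
    unfolding roman_domination_number_def by (rule LeastI_ex)
qed

lemma roman_domination_number_le:
  "roman_dominating G f \<Longrightarrow> \<gamma>\<^sub>R G \<le> rdf_weight G f"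
  unfolding roman_domination_number_def by (rule Least_le) blast

text \<open>\<open>Orig v\<close>, \<open>Copy v\<close> and \<open>Apex\<close> stand for \<open>v\<^sup>0\<close>, \<open>v\<^sup>1\<close> and \<open>u\<close>, respectively.\<close>

datatype 'a mycielski_vertex = Orig 'a | Copy 'a | Apex

definition mycielskian :: "'a pair_pre_digraph \<Rightarrow> 'a mycielski_vertex pair_pre_digraph" where
  "mycielskian G =
     \<lparr> pverts = Orig ` pverts G \<union> Copy ` pverts G \<union> {Apex},
       parcs =
         {(Orig v, Orig w) | v w. (v, w) \<in> parcs G} \<union>
         {(Orig v, Copy w) | v w. (v, w) \<in> parcs G} \<union>
         {(Copy w, Orig v) | v w. (v, w) \<in> parcs G} \<union>
         {(Copy v, Apex) | v. v \<in> pverts G} \<union>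
         {(Apex, Copy v) | v. v \<in> pverts G} \<rparr>"

lemma pair_graph_mycielskian:
  assumes "pair_graph G"
  shows "pair_graph (mycielskian G)"
proof -
  interpret pair_graph G by (fact assms)
  have sym: "(w, v) \<in> parcs G" if "(v, w) \<in> parcs G" for v w
    using that pair_sym_arcs by (auto simp: symmetric_def dest: symD)
  let ?M = "mycielskian G"
  have fin: "finite (pverts ?M)"
    by (simp add: mycielskian_def pair_finite_verts)
  have sub: "parcs ?M \<subseteq> pverts ?M \<times> pverts ?M"
    by (auto simp: mycielskian_def dest: in_arcsD1 in_arcsD2)
  show ?thesis
  proof
    show "finite (parcs ?M)"
      by (rule finite_subset[OF sub finite_cartesian_product[OF fin fin]])
    show "symmetric ?M"
      unfolding symmetric_def by (auto simp: mycielskian_def sym_def dest: sym)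
    show "fst e \<noteq> snd e" if "e \<in> parcs ?M" for e
      using that by (auto simp: mycielskian_def dest: pair_no_loops)
  qed (use sub fin in auto)
qed

end

(*
  Upper bound: put 2 on the apex, 0 on the copies and an optimal f on the originals; a copy is
  dominated by the apex, so only the weight 2 is added.
  Lower bound: fold a function h on the Mycielskian down to G. If h is positive on the apex, then
  the sum of h over v and its copy, capped at 2, works and saves the value at the apex. If h
  vanishes on the apex, then some copy has value 2, and no copy is dominated by the apex, so every
  copy of value 0 is dominated by an original; hence the value of a copy may be capped at 1
  before taking the maximum with the value of the original, which saves at least 1.
*)

theory Submission
  imports Defs
begin

lemma rdf_weight_mycielskian:
  assumes "finite (pverts G)"
  shows "rdf_weight (mycielskian G) h = (\<Sum>v\<in>pverts G. h (Orig v) + h (Copy v)) + h Apex"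
proof -
  have "rdf_weight (mycielskian G) h
      = sum h (Orig ` pverts G) + sum h (Copy ` pverts G) + h Apex"
    unfolding rdf_weight_def mycielskian_def using assms
    by (subst pair_pre_digraph.simps, subst sum.union_disjoint; (subst sum.union_disjoint)?) auto
  moreover have "sum h (Orig ` pverts G) = (\<Sum>v\<in>pverts G. h (Orig v))"
    by (subst sum.reindex) (auto simp: inj_on_def)
  moreover have "sum h (Copy ` pverts G) = (\<Sum>v\<in>pverts G. h (Copy v))"
    by (subst sum.reindex) (auto simp: inj_on_def)
  ultimately show ?thesis
    by (simp add: sum.distrib)
qed

text \<open>An original is adjacent to originals and copies, a copy to originals and the apex, and
  the apex exactly to the copies. In the clause for copies the arc is \<open>(w, v)\<close>, the
  direction in which \<open>mycielskian\<close> produces it.\<close>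

lemma roman_dominating_mycielskian_iff:
  "roman_dominating (mycielskian G) h \<longleftrightarrow>
     (\<forall>v\<in>pverts G. h (Orig v) \<le> 2 \<and> h (Copy v) \<le> 2) \<and> h Apex \<le> 2 \<and>
     (\<forall>v\<in>pverts G. h (Orig v) = 0 \<longrightarrow>
        (\<exists>w\<in>pverts G. (v, w) \<in> parcs G \<and> (h (Orig w) = 2 \<or> h (Copy w) = 2))) \<and>
     (\<forall>v\<in>pverts G. h (Copy v) = 0 \<longrightarrow>
        h Apex = 2 \<or> (\<exists>w\<in>pverts G. (w, v) \<in> parcs G \<and> h (Orig w) = 2)) \<and>
     (h Apex = 0 \<longrightarrow> (\<exists>v\<in>pverts G. h (Copy v) = 2))"
proof -
  have [simp]: "k = 0 \<or> k = Suc 0 \<or> k = 2 \<longleftrightarrow> k \<le> 2" for k :: nat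
    by auto
  show ?thesis
    unfolding roman_dominating_def mycielskian_def
    by (simp add: ball_Un bex_Un) blast
qed

lemma roman_domination_number_mycielskian_le:
  assumes "pair_graph G"
  shows "\<gamma>\<^sub>R (mycielskian G) \<le> \<gamma>\<^sub>R G + 2"
proof -
  interpret pair_graph G by (fact assms)
  obtain f where f: "roman_dominating G f" "rdf_weight G f = \<gamma>\<^sub>R G"
    using roman_domination_number_attained by blast
  define h where "h = case_mycielski_vertex f (\<lambda>_. 0) (2 :: nat)"
  have "roman_dominating (mycielskian G) h"
    \<comment> \<open>An original of value 0 keeps the neighbor of value 2 that it has under
      \<open>f\<close>.\<close>
    using f(1) unfolding roman_dominating_mycielskian_iff
    by (auto simp: roman_dominating_def h_def)
  then have "\<gamma>\<^sub>R (mycielskian G) \<le> rdf_weight (mycielskian G) h"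
    by (rule roman_domination_number_le)
  also have "\<dots> = \<gamma>\<^sub>R G + 2"
    by (simp add: rdf_weight_mycielskian pair_finite_verts h_def flip: f(2) rdf_weight_def)
  finally show ?thesis .
qed

lemma roman_domination_number_less_mycielskian:
  assumes "pair_graph G"
  shows "\<gamma>\<^sub>R G < \<gamma>\<^sub>R (mycielskian G)"
proof -
  interpret pair_graph G by (fact assms)
  have sym: "(w, v) \<in> parcs G" if "(v, w) \<in> parcs G" for v w
    using that pair_sym_arcs by (auto simp: symmetric_def dest: symD)
  obtain h where h: "roman_dominating (mycielskian G) h"
    and weight_h: "rdf_weight (mycielskian G) h = \<gamma>\<^sub>R (mycielskian G)"
    using roman_domination_number_attained by blast
  note dom = h[unfolded roman_dominating_mycielskian_iff]
  have le_2: "k \<in> {0, 1, 2}" if "k \<le> 2" for k :: nat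
    using that by auto
  have "\<exists>f. roman_dominating G f \<and> rdf_weight G f < rdf_weight (mycielskian G) h"
  proof (cases "h Apex = 0")
    case False
    define f where "f v = min 2 (h (Orig v) + h (Copy v))" for v
    have "roman_dominating G f"
      unfolding roman_dominating_def
    proof (intro conjI ballI impI)
      show "f v \<in> {0, 1, 2}" for v
        by (rule le_2) (simp add: f_def)
      fix v assume "v \<in> pverts G" "f v = 0"
      \<comment> \<open>Since \<open>f v = 0\<close> forces \<open>h (Orig v) = 0\<close>, the
        original has a neighbor of value 2 over some \<open>w\<close>; whether it is an original or
        a copy, the capped sum at \<open>w\<close> is 2.\<close>
      then obtain w where "w \<in> pverts G" "(v, w) \<in> parcs G" "h (Orig w) = 2 \<or> h (Copy w) = 2"
        using dom by (auto simp: f_def min_def split: if_splits)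
      then show "\<exists>w\<in>pverts G. (v, w) \<in> parcs G \<and> f w = 2"
        by (intro bexI[of _ w]) (auto simp: f_def)
    qed
    moreover have "rdf_weight G f \<le> (\<Sum>v\<in>pverts G. h (Orig v) + h (Copy v))"
      unfolding rdf_weight_def by (rule sum_mono) (simp add: f_def)
    ultimately show ?thesis
      using False by (intro exI[of _ f]) (simp add: rdf_weight_mycielskian pair_finite_verts)
  next
    case True
    define f where "f v = max (h (Orig v)) (min 1 (h (Copy v)))" for v
    have "roman_dominating G f"
      unfolding roman_dominating_def
    proof (intro conjI ballI impI)
      show "f v \<in> {0, 1, 2}" if "v \<in> pverts G" for v
        using dom that by (intro le_2) (auto simp: f_def)
      fix v assume "v \<in> pverts G" "f v = 0"
      \<comment> \<open>A copy of value 2 next to \<open>Orig v\<close> would be of no use, as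
        \<open>f\<close> may lower it to 1. The argument uses \<open>h (Copy v) = 0\<close> instead:
        this copy needs an original of value 2, which the maximum preserves.\<close>
      then obtain w where "w \<in> pverts G" "(w, v) \<in> parcs G" "h (Orig w) = 2"
        using dom True by (auto simp: f_def max_def min_def split: if_splits)
      then show "\<exists>w\<in>pverts G. (v, w) \<in> parcs G \<and> f w = 2"
        by (intro bexI[of _ w]) (auto simp: f_def dest: sym)
    qed
    moreover obtain w where "w \<in> pverts G" "h (Copy w) = 2"
      using dom True by blast
    \<comment> \<open>Pointwise max a (min 1 b) \<le> a + b, and at \<open>w\<close>, where b = 2,
      the left side is max a 1 < a + 2.\<close>
    then have "rdf_weight G f < (\<Sum>v\<in>pverts G. h (Orig v) + h (Copy v))"
      unfolding rdf_weight_def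
      by (intro sum_strict_mono_ex1 ballI bexI[of _ w]) (auto simp: f_def pair_finite_verts)
    ultimately show ?thesis
      by (intro exI[of _ f]) (simp add: rdf_weight_mycielskian pair_finite_verts)
  qed
  then show ?thesis
    using roman_domination_number_le weight_h by fastforce
qed

theorem theorem1:
  fixes G :: "'a pair_pre_digraph"
  assumes "pair_graph G"
  shows "\<gamma>\<^sub>R G + 1 \<le> \<gamma>\<^sub>R (mycielskian G) \<and> \<gamma>\<^sub>R (mycielskian G) \<le> \<gamma>\<^sub>R G + 2"
  using roman_domination_number_less_mycielskian[OF assms]
    roman_domination_number_mycielskian_le[OF assms] by simp

end
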